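(* Let $c\in\mathbb{C}$, $r>0$, and let $k=k_1k_2$ with $k_1,k_2$ positive integers. Let $M(z)=\frac{1-z}{z}$. Then, as rational functions of $z$, $$R_{c,r,k}(z)=R_{0,1,k_2}\big(M(R_{c,r,k_1}(z))\big).$$ Let $\sigma_1^{(k_2)},\dots,\sigma_{k_2}^{(k_2)}$ be the $k_2$ roots of $x^{k_2}=-1$, and for each $i$ with $\sigma_i^{(k_2)}\ne-1$ put $$c_i^{(k_2)}=-\frac{1}{k_2}\,\frac{\sigma_i^{(k_2)}}{1+\sigma_i^{(k_2)}},\qquad s_i^{(k_2)}=\frac{1}{1+\sigma_i^{(k_2)}}.$$ If $k_2$ is even, then $$R_{c,r,k}(z)=\sum_{i=1}^{k_2}c_i^{(k_2)}\big(s_i^{(k_2)}-R_{c,r,k_1}(z)\big)^{-1}R_{c,r,k_1}(z).$$ If $k_2$ is odd, and the roots are ordered so that $\sigma_{k_2}^{(k_2)}=-1$, then $$R_{c,r,k}(z)=\sum_{i=1}^{k_2-1}c_i^{(k_2)}\big(s_i^{(k_2)}-R_{c,r,k_1}(z)\big)^{-1}R_{c,r,k_1}(z)+\frac{1}{k_2}R_{c,r,k_1}(z).$$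
   Context: For $c\in\mathbb{C}$, $r>0$ and a positive integer $k$, $R_{c,r,k}$ is the rational function obtained from the $k$-point trapezoidal quadrature of $\frac{1}{2\pi\imath}\oint_{|\zeta-c|=r}\frac{1}{\zeta-z}\,\mathrm{d}\zeta$: $R_{c,r,k}(z)=\sum_{i=1}^k\frac{w_i^{(k)}}{p_i^{(k)}-z}$ with $p_i^{(k)}=re^{\imath\theta_i^{(k)}}+c$, $w_i^{(k)}=re^{\imath\theta_i^{(k)}}/k$, $\theta_i^{(k)}=(2i-1)\pi/k$, $i=1,\dots,k$. In particular $R_{0,1,k}(z)=\frac1k\sum_{i=1}^k\frac{\sigma_i^{(k)}}{\sigma_i^{(k)}-z}$, where $\sigma_1^{(k)},\dots,\sigma_k^{(k)}$ are the roots of $x^k=-1$. *)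

theory Defs
  imports
    "HOL-Analysis.Analysis"
    "HOL-Computational_Algebra.Polynomial_Factorial"
    "HOL-Computational_Algebra.Field_as_Ring"
begin

text \<open>Rational functions over the complex numbers are the elements of the field of fractions of
  the polynomial ring, so that an equation between them is an identity of rational functions,
  not of partial functions on the complex plane.\<close>

type_synonym ratfun = "complex poly fract"

definition rf_const :: "complex \<Rightarrow> ratfun" where
  "rf_const a = to_fract [:a:]"

definition rf_Z :: ratfun where
  "rf_Z = to_fract [:0, 1:]"

definition rf_eval_poly :: "complex poly \<Rightarrow> ratfun \<Rightarrow> ratfun" where
  "rf_eval_poly p g = poly (map_poly rf_const p) g"

text \<open>The composite \<open>f \<circ> g\<close>, by substituting \<open>g\<close> into the reduced fraction for \<open>f\<close>.
  It is undefined (and then \<open>0\<close> by convention) only if \<open>g\<close> is a constant that is a pole of \<open>f\<close>.\<close>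

definition rf_comp :: "ratfun \<Rightarrow> ratfun \<Rightarrow> ratfun" where
  "rf_comp f g = rf_eval_poly (fst (quot_of_fract f)) g / rf_eval_poly (snd (quot_of_fract f)) g"

definition trap_angle :: "nat \<Rightarrow> nat \<Rightarrow> real" where
  "trap_angle k i = (2 * real i - 1) * pi / real k"

definition trap_node :: "complex \<Rightarrow> real \<Rightarrow> nat \<Rightarrow> nat \<Rightarrow> complex" where
  "trap_node c r k i = complex_of_real r * exp (\<i> * complex_of_real (trap_angle k i)) + c"

definition trap_weight :: "real \<Rightarrow> nat \<Rightarrow> nat \<Rightarrow> complex" where
  "trap_weight r k i = complex_of_real r * exp (\<i> * complex_of_real (trap_angle k i)) / of_nat k"

definition trap_R :: "complex \<Rightarrow> real \<Rightarrow> nat \<Rightarrow> ratfun" where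
  "trap_R c r k =
     (\<Sum>i = 1..k. rf_const (trap_weight r k i) / (rf_const (trap_node c r k i) - rf_Z))"

definition rf_M :: ratfun where
  "rf_M = (1 - rf_Z) / rf_Z"

definition coef_c :: "nat \<Rightarrow> complex \<Rightarrow> complex" where
  "coef_c m \<sigma> = - (1 / of_nat m) * (\<sigma> / (1 + \<sigma>))"

definition shift_s :: "complex \<Rightarrow> complex" where
  "shift_s \<sigma> = 1 / (1 + \<sigma>)"

lemma rf_const_0 [simp]: "rf_const 0 = 0"
  and rf_const_add: "rf_const (a + b) = rf_const a + rf_const b"
  and rf_const_mult: "rf_const (a * b) = rf_const a * rf_const b"
  by (simp_all add: rf_const_def flip: to_fract_add to_fract_mult)

lemma rf_eval_poly_pCons: "rf_eval_poly (pCons a p) g = rf_const a + g * rf_eval_poly p g"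
  by (simp add: rf_eval_poly_def map_poly_pCons)

lemma rf_eval_poly_0 [simp]: "rf_eval_poly 0 g = 0"
  by (simp add: rf_eval_poly_def)

lemma rf_eval_poly_add: "rf_eval_poly (p + q) g = rf_eval_poly p g + rf_eval_poly q g"
  by (induction p q rule: poly_induct2) (simp_all add: rf_eval_poly_pCons rf_const_add algebra_simps)

lemma rf_eval_poly_smult: "rf_eval_poly (smult a p) g = rf_const a * rf_eval_poly p g"
  by (induction p) (simp_all add: rf_eval_poly_pCons rf_const_mult algebra_simps)

lemma rf_eval_poly_mult: "rf_eval_poly (p * q) g = rf_eval_poly p g * rf_eval_poly q g"
  by (induction p)
     (simp_all add: rf_eval_poly_pCons rf_eval_poly_add rf_eval_poly_smult algebra_simps)

text \<open>Any fraction representing \<open>f\<close> may be used for substitution as long as its denominator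
  does not vanish.\<close>

lemma rf_comp_Fract:
  assumes "rf_eval_poly q g \<noteq> 0"
  shows "rf_comp (Fract p q) g = rf_eval_poly p g / rf_eval_poly q g"
proof -
  define a where "a = fst (quot_of_fract (Fract p q))"
  define b where "b = snd (quot_of_fract (Fract p q))"
  have q: "q \<noteq> 0" using assms by auto
  have b: "b \<noteq> 0" by (simp add: b_def)
  have "Fract a b = Fract p q" by (simp add: a_def b_def)
  hence eq: "a * q = p * b" using q b by (simp add: eq_fract)
  have "coprime b a"
    using coprime_quot_of_fract[of "Fract p q"] by (simp add: a_def b_def coprime_commute)
  moreover have "b dvd a * q" by (simp add: eq)
  ultimately have "b dvd q" by (simp add: coprime_dvd_mult_right_iff)
  then obtain d where "q = b * d" by (elim dvdE)
  hence B: "rf_eval_poly b g \<noteq> 0" using assms by (auto simp: rf_eval_poly_mult)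
  have "rf_eval_poly a g * rf_eval_poly q g = rf_eval_poly p g * rf_eval_poly b g"
    by (simp add: eq flip: rf_eval_poly_mult)
  thus ?thesis using assms B
    by (simp add: rf_comp_def a_def [symmetric] b_def [symmetric] divide_simps)
qed

lemma trap_node_inj:
  assumes "r > 0" "k > 0"
  shows "inj_on (trap_node c r k) {1..k}"
proof (rule inj_onI)
  fix i j assume ij: "i \<in> {1..k}" "j \<in> {1..k}" "trap_node c r k i = trap_node c r k j"
  hence "exp (\<i> * complex_of_real (trap_angle k i)) = exp (\<i> * complex_of_real (trap_angle k j))"
    using assms by (simp add: trap_node_def)
  then obtain n :: int where
    "\<i> * complex_of_real (trap_angle k i) = \<i> * complex_of_real (trap_angle k j)
       + complex_of_real (2 * of_int n * pi) * \<i>"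
    by (auto simp: exp_eq)
  hence "\<i> * complex_of_real (trap_angle k i) = \<i> * complex_of_real (trap_angle k j + 2 * of_int n * pi)"
    by (simp add: algebra_simps)
  hence "trap_angle k i = trap_angle k j + 2 * of_int n * pi"
    by (metis mult_left_cancel complex_i_not_zero of_real_eq_iff)
  hence "real i * pi = (real j + of_int n * real k) * pi"
    using assms by (simp add: trap_angle_def field_simps)
  hence "real i = real j + of_int n * real k" by simp
  hence "of_int (int i) = (of_int (int j + n * int k) :: real)" by simp
  hence *: "int i = int j + n * int k" by (simp only: of_int_eq_iff)
  have "n = 0"
  proof (rule ccontr)
    assume "n \<noteq> 0"
    hence "\<bar>n * int k\<bar> \<ge> int k" using assms by (simp add: abs_mult mult_le_cancel_right1)
    thus False using * ij by auto
  qed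
  thus "i = j" using * by simp
qed

text \<open>\<open>trap_R c r k\<close> is not constant, so the denominators obtained by substituting it
  into a rational function do not vanish.\<close>

lemma trap_R_nonconst:
  assumes "r > 0" "k > 0"
  shows "trap_R c r k \<noteq> rf_const a"
proof
  assume eq: "trap_R c r k = rf_const a"
  define l where "l = (\<lambda>i. [:trap_node c r k i, -1:])"
  define P where "P = (\<lambda>A. \<Prod>i\<in>A. l i)"
  have l: "rf_const (trap_node c r k i) - rf_Z = to_fract (l i)" for i
    by (simp add: l_def rf_const_def rf_Z_def flip: to_fract_diff)
  have nz: "to_fract (l i) \<noteq> 0" for i by (simp add: l_def)
  have P: "P {1..k} = l i * P ({1..k} - {i})" if "i \<in> {1..k}" for i
    unfolding P_def by (rule prod.remove) (use that in simp_all)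
  have "to_fract ([:a:] * P {1..k}) = trap_R c r k * to_fract (P {1..k})"
    by (simp only: eq rf_const_def to_fract_mult)
  also have "\<dots> = (\<Sum>i = 1..k. to_fract [:trap_weight r k i:] / to_fract (l i) * to_fract (P {1..k}))"
    by (simp only: trap_R_def l sum_distrib_right) (simp only: rf_const_def)
  also have "\<dots> = (\<Sum>i = 1..k. to_fract ([:trap_weight r k i:] * P ({1..k} - {i})))"
  proof (rule sum.cong)
    fix i assume i: "i \<in> {1..k}"
    show "to_fract [:trap_weight r k i:] / to_fract (l i) * to_fract (P {1..k}) =
          to_fract ([:trap_weight r k i:] * P ({1..k} - {i}))"
      unfolding P[OF i] to_fract_mult using nz[of i] by (simp del: to_fract_mult)
  qed simp
  also have "\<dots> = to_fract (\<Sum>i = 1..k. [:trap_weight r k i:] * P ({1..k} - {i}))"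
    by (rule to_fract_sum [symmetric])
  finally have "[:a:] * P {1..k} = (\<Sum>i = 1..k. [:trap_weight r k i:] * P ({1..k} - {i}))"
    by (simp only: to_fract_eq_iff)
  hence "poly ([:a:] * P {1..k}) (trap_node c r k 1) =
         poly (\<Sum>i = 1..k. [:trap_weight r k i:] * P ({1..k} - {i})) (trap_node c r k 1)"
    by (rule arg_cong)
  also have "poly ([:a:] * P {1..k}) (trap_node c r k 1) = 0"
    using assms by (subst P[of 1]) (simp_all add: l_def)
  also have "poly (\<Sum>i = 1..k. [:trap_weight r k i:] * P ({1..k} - {i})) (trap_node c r k 1) =
     (\<Sum>i = 1..k. if i = 1 then trap_weight r k 1 * poly (P ({1..k} - {1})) (trap_node c r k 1) else 0)"
    unfolding poly_sum
  proof (rule sum.cong)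
    fix i assume "i \<in> {1..k}"
    moreover have "poly (P ({1..k} - {i})) (trap_node c r k 1) = 0" if "i \<noteq> 1"
      using that assms by (auto simp: P_def poly_prod l_def intro!: bexI[of _ 1])
    ultimately show "poly ([:trap_weight r k i:] * P ({1..k} - {i})) (trap_node c r k 1) =
      (if i = 1 then trap_weight r k 1 * poly (P ({1..k} - {1})) (trap_node c r k 1) else 0)"
      by auto
  qed simp
  also have "\<dots> = trap_weight r k 1 * poly (P ({1..k} - {1})) (trap_node c r k 1)"
    using assms by simp
  finally have "trap_weight r k 1 * poly (P ({1..k} - {1})) (trap_node c r k 1) = 0"
    by simp
  moreover have "trap_weight r k 1 \<noteq> 0" using assms by (simp add: trap_weight_def)
  moreover have "poly (P ({1..k} - {1})) (trap_node c r k 1) \<noteq> 0"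
  proof -
    have "trap_node c r k i \<noteq> trap_node c r k 1" if "i \<in> {1..k} - {1}" for i
      using inj_onD[OF trap_node_inj[OF assms, of c], of i 1] that assms by auto
    thus ?thesis unfolding P_def poly_prod by (subst prod_zero_iff) (simp_all add: l_def)
  qed
  ultimately show False by simp
qed

end

theory Submission
  imports Defs
begin

text \<open>The logarithmic derivative of \<open>X\<^sup>m - a = \<Prod>\<^sub>\<sigma> (X - \<sigma>)\<close>, evaluated at \<open>g\<close> for \<open>a = -1\<close>, gives the
  partial fraction expansion \<open>1 / (1 + g\<^sup>m) = (1/m) \<Sum>\<^sub>\<sigma> \<sigma> / (\<sigma> - g)\<close>. With \<open>w = (z - c) / r\<close> it
  reads \<open>R\<^sub>c\<^sub>,\<^sub>r\<^sub>,\<^sub>k = 1 / (1 + w\<^sup>k)\<close>. Since \<open>M(1 / (1 + g)) = g\<close>, the composition formula amounts to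
  \<open>w\<^sup>k = (w\<^bsup>k1\<^esup>)\<^bsup>k2\<^esup>\<close>, and the two sums are the expansion at \<open>g = w\<^bsup>k1\<^esup>\<close> rewritten in terms of
  \<open>R = 1 / (1 + g)\<close>.\<close>

lemma bij_betw_atLeastAtMost_remove_last:
  fixes n :: nat
  assumes "bij_betw f {1..n} A" and "n > 0"
  shows "bij_betw f {1..n - 1} (A - {f n})"
proof -
  have "bij_betw f ({1..n} - {n}) (A - {f n})"
    using assms by (intro bij_betw_DiffI) (auto simp: bij_betw_def)
  moreover have "{1..n} - {n} = {1..n - 1}" by auto
  ultimately show ?thesis by simp
qed

lemma poly_pderiv_prod_linear_factors:
  fixes g :: "'a::field"
  assumes "g \<notin> S"
  shows "poly (pderiv (\<Prod>x\<in>S. [:-x, 1:])) g = poly (\<Prod>x\<in>S. [:-x, 1:]) g * (\<Sum>x\<in>S. 1 / (g - x))"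
proof (cases "finite S")
  case True
  have "(\<Prod>y\<in>S - {x}. g - y) = (\<Prod>y\<in>S. g - y) * (1 / (g - x))" if "x \<in> S" for x
    using that True assms by (auto simp: prod.remove)
  then show ?thesis
    by (simp add: pderiv_prod pderiv_pCons poly_sum poly_prod sum_distrib_left)
qed simp

lemma prod_linear_factors_nth_roots:
  fixes a :: "'a::field"
  assumes "n > 0" and "card S = n" and roots: "\<And>x. x \<in> S \<Longrightarrow> x ^ n = a"
  shows "(\<Prod>x\<in>S. [:-x, 1:]) = monom 1 n - [:a:]"
proof (rule poly_eqI_degree_lead_coeff)
  let ?P = "\<Prod>x\<in>S. [:-x, 1:]"
  have "finite S" using assms by (simp add: card_ge_0_finite)
  have degree: "degree ?P = n"
    using assms by (simp add: degree_prod_sum_eq)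
  have "coeff ?P n = lead_coeff ?P" by (simp only: degree)
  also have "\<dots> = 1" by (simp add: lead_coeff_prod)
  finally show "coeff ?P n = coeff (monom 1 n - [:a:]) n"
    using assms by (simp add: coeff_pCons split: nat.split)
  show "degree ?P \<le> n" by (simp add: degree)
  show "degree (monom 1 n - [:a:]) \<le> n" by (intro degree_diff_le) (simp_all add: degree_monom_le)
  show "card S \<ge> n" using assms by simp
  show "poly ?P x = poly (monom 1 n - [:a:]) x" if "x \<in> S" for x
    using that \<open>finite S\<close> roots by (auto simp: poly_prod poly_monom)
qed

lemma sum_partial_fractions_nth_roots:
  fixes a g :: "'a::field"
  assumes "n > 0" and "card S = n" and roots: "\<And>x. x \<in> S \<Longrightarrow> x ^ n = a" and "g ^ n \<noteq> a"
  shows "(\<Sum>x\<in>S. x / (x - g)) = of_nat n * a / (a - g ^ n)"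
proof -
  let ?s = "\<Sum>x\<in>S. 1 / (g - x)"
  have "g \<notin> S" using assms by auto
  have "x / (x - g) = 1 - g * (1 / (g - x))" if "x \<in> S" for x
    using that \<open>g \<notin> S\<close> by (auto simp: divide_simps) (simp add: algebra_simps)
  then have sum_conv: "(\<Sum>x\<in>S. x / (x - g)) = of_nat n - g * ?s"
    using assms by (simp add: sum_subtractf sum_distrib_left)
  have "of_nat n * g ^ (n - 1) = (g ^ n - a) * ?s"
    using poly_pderiv_prod_linear_factors[OF \<open>g \<notin> S\<close>]
      prod_linear_factors_nth_roots[OF assms(1,2) roots]
    by (simp add: pderiv_diff pderiv_monom pderiv_pCons poly_monom)
  then have "of_nat n * (g ^ (n - 1) * g) = (g ^ n - a) * (g * ?s)"
    by (metis mult.assoc mult.commute)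
  then have "of_nat n * g ^ n = (g ^ n - a) * (g * ?s)"
    by (simp only: power_minus_mult[OF \<open>n > 0\<close>])
  then have "(of_nat n - g * ?s) * (a - g ^ n) = of_nat n * a"
    by (simp add: algebra_simps)
  with \<open>g ^ n \<noteq> a\<close> show ?thesis
    by (simp add: sum_conv nonzero_eq_divide_eq)
qed

lemma moebius_partial_fraction:
  fixes x g :: "'a::field"
  assumes "1 + x \<noteq> 0" and "1 + g \<noteq> 0"
  shows "- (x / (1 + x)) * inverse (1 / (1 + x) - 1 / (1 + g)) * (1 / (1 + g)) = x / (x - g)"
proof -
  have "1 / (1 + x) - 1 / (1 + g) = (g - x) / ((1 + x) * (1 + g))"
    using assms by (simp add: diff_frac_eq)
  then have "- (x / (1 + x)) * inverse (1 / (1 + x) - 1 / (1 + g)) * (1 / (1 + g)) = - (x / (g - x))"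
    using assms by simp
  also have "\<dots> = x / (x - g)"
    by (metis minus_diff_eq minus_divide_right)
  finally show ?thesis .
qed

instance fract :: ("{idom, ring_char_0}") field_char_0
proof
  show "inj (of_nat :: nat \<Rightarrow> 'a fract)"
    by (rule injI) (simp add: of_nat_fract eq_fract)
qed

lemma to_fract_power: "to_fract (p ^ n) = to_fract p ^ n"
  by (induction n) simp_all

lemma rf_const_1 [simp]: "rf_const 1 = 1"
  by (simp add: rf_const_def flip: one_pCons)

lemma rf_const_minus: "rf_const (- a) = - rf_const a"
  using rf_const_add[of a "- a"] by (simp add: add_eq_0_iff)

lemma rf_const_eq_iff [simp]: "rf_const a = rf_const b \<longleftrightarrow> a = b"
  by (simp add: rf_const_def)

lemma rf_const_eq_0_iff [simp]: "rf_const a = 0 \<longleftrightarrow> a = 0"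
  by (simp add: rf_const_def)

lemma rf_const_divide: "rf_const (a / b) = rf_const a / rf_const b"
proof (cases "b = 0")
  case False
  then have "rf_const a = rf_const (a / b) * rf_const b"
    by (simp flip: rf_const_mult)
  then show ?thesis using False by (simp add: field_simps)
qed simp

lemma rf_const_power: "rf_const (a ^ n) = rf_const a ^ n"
  by (induction n) (simp_all add: rf_const_mult)

lemma rf_const_of_nat: "rf_const (of_nat n) = of_nat n"
  by (induction n) (simp_all add: rf_const_add)

lemma rf_eval_poly_1 [simp]: "rf_eval_poly 1 g = 1"
  by (simp add: one_pCons rf_eval_poly_pCons)

lemma rf_eval_poly_power: "rf_eval_poly (p ^ n) g = rf_eval_poly p g ^ n"
  by (induction n) (simp_all add: rf_eval_poly_mult)

lemma partial_fractions_one_plus_power: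
  assumes "m > 0" and "1 + g ^ m \<noteq> 0"
  shows "(\<Sum>x | x ^ m = -1. rf_const (x / of_nat m) / (rf_const x - g)) = 1 / (1 + g ^ m)"
proof -
  let ?S = "{x :: complex. x ^ m = -1}"
  have inj: "inj_on rf_const ?S" by (simp add: inj_on_def)
  have "(\<Sum>x\<in>?S. rf_const (x / of_nat m) / (rf_const x - g))
      = (\<Sum>y\<in>rf_const ` ?S. y / (y - g)) / of_nat m"
    by (simp add: sum.reindex[OF inj] rf_const_divide rf_const_of_nat sum_divide_distrib mult.commute)
  also have "(\<Sum>y\<in>rf_const ` ?S. y / (y - g)) = of_nat m * (-1) / (-1 - g ^ m)"
  proof (rule sum_partial_fractions_nth_roots)
    show "card (rf_const ` ?S) = m"
      using assms by (simp add: card_image[OF inj] card_nth_roots)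
    show "y ^ m = -1" if "y \<in> rf_const ` ?S" for y
      using that by (auto simp: rf_const_minus simp flip: rf_const_power)
    show "g ^ m \<noteq> -1"
      using assms by auto
  qed (use assms in auto)
  also have "-1 - g ^ m = - (1 + g ^ m)" by simp
  also have "of_nat m * (-1) / - (1 + g ^ m) / of_nat m = 1 / (1 + g ^ m)"
    using \<open>m > 0\<close> by (simp del: minus_add_distrib)
  finally show ?thesis .
qed

text \<open>Under \<open>R = 1 / (1 + g)\<close> the pole \<open>g = x\<close> moves to \<open>R = shift_s x\<close>. The pole \<open>g = -1\<close> moves to
  infinity, where \<open>shift_s (-1)\<close> is the junk value \<open>1 / 0 = 0\<close>; it contributes the linear term
  for odd \<open>m\<close>.\<close>

definition pole_term :: "nat \<Rightarrow> complex \<Rightarrow> ratfun \<Rightarrow> ratfun" where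
  "pole_term m x R = rf_const (coef_c m x) * inverse (rf_const (shift_s x) - R) * R"

lemma pole_term_inverse_one_plus:
  assumes "x \<noteq> -1" and "1 + g \<noteq> 0"
  shows "pole_term m x (1 / (1 + g)) = rf_const (x / of_nat m) / (rf_const x - g)"
proof -
  have "rf_const (1 + x) \<noteq> 0"
    using assms by (simp add: add_eq_0_iff)
  then have "1 + rf_const x \<noteq> 0" by (simp add: rf_const_add)
  have "pole_term m x (1 / (1 + g)) = - (rf_const x / (1 + rf_const x))
      * inverse (1 / (1 + rf_const x) - 1 / (1 + g)) * (1 / (1 + g)) / of_nat m"
    by (simp add: pole_term_def coef_c_def shift_s_def rf_const_minus rf_const_mult rf_const_divide
        rf_const_add rf_const_of_nat)
  also have "\<dots> = rf_const x / (rf_const x - g) / of_nat m"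
    by (simp only: moebius_partial_fraction[OF \<open>1 + rf_const x \<noteq> 0\<close> assms(2)])
  finally show ?thesis by (simp add: rf_const_divide rf_const_of_nat)
qed

lemma inverse_one_plus_power_conv_pole_terms:
  assumes "m > 0" and "1 + g \<noteq> 0" and "1 + g ^ m \<noteq> 0"
  shows "1 / (1 + g ^ m) = (\<Sum>x\<in>{x. x ^ m = -1} - {-1}. pole_term m x (1 / (1 + g)))
    + (if odd m then rf_const (1 / of_nat m) * (1 / (1 + g)) else 0)"
proof -
  let ?f = "\<lambda>x. rf_const (x / of_nat m) / (rf_const x - g)"
  let ?S = "{x :: complex. x ^ m = -1}"
  have pole_terms: "(\<Sum>x\<in>?S - {-1}. pole_term m x (1 / (1 + g))) = sum ?f (?S - {-1})"
    using assms by (intro sum.cong) (simp_all add: pole_term_inverse_one_plus)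
  have "1 / (1 + g ^ m) = sum ?f ?S"
    using assms by (simp add: partial_fractions_one_plus_power)
  also have "\<dots> = sum ?f (?S - {-1}) + (if odd m then ?f (-1) else 0)"
  proof (cases "odd m")
    case True
    then have "sum ?f ?S = ?f (-1) + sum ?f (?S - {-1})"
      using assms by (intro sum.remove finite_nth_roots) auto
    with True show ?thesis by simp
  qed simp
  also have "?f (-1) = rf_const (1 / of_nat m) * (1 / (1 + g))"
    using minus_divide_divide[of "rf_const (1 / of_nat m)" "1 + g"] by (simp add: rf_const_minus)
  finally show ?thesis by (simp only: pole_terms)
qed

definition rf_scaled :: "complex \<Rightarrow> real \<Rightarrow> ratfun" where
  "rf_scaled c r = (rf_Z - rf_const c) / rf_const (of_real r)"

lemma rf_scaled_conv_to_fract: "rf_scaled c r = to_fract [:- c / of_real r, 1 / of_real r:]"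
proof (cases "r = 0")
  case False
  have "to_fract [:- c / of_real r, 1 / of_real r:] * rf_const (of_real r) = rf_Z - rf_const c"
    using False by (simp add: rf_const_def rf_Z_def flip: to_fract_mult to_fract_diff)
  with False show ?thesis by (simp add: rf_scaled_def field_simps)
qed (simp add: rf_scaled_def)

lemma one_plus_rf_scaled_power_nonzero: "1 + rf_scaled c r ^ k \<noteq> 0"
proof
  let ?p = "1 + [:- c / of_real r, 1 / of_real r:] ^ k"
  assume "1 + rf_scaled c r ^ k = 0"
  moreover have "to_fract ?p = 1 + rf_scaled c r ^ k"
    by (simp add: rf_scaled_conv_to_fract to_fract_power)
  ultimately have "?p = 0" by (metis to_fract_eq_0_iff)
  then have "poly ?p c = 0" by simp
  then show False by (simp add: power_0_left split: if_splits)
qed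

lemma unit_trap_node_power:
  assumes "m > 0"
  shows "trap_node 0 1 m i ^ m = -1"
proof -
  have "trap_node 0 1 m i ^ m = cis (real m * trap_angle m i)"
    by (simp add: trap_node_def Complex.DeMoivre flip: cis_conv_exp)
  also have "real m * trap_angle m i = 2 * pi * real i - pi"
    using assms by (simp add: trap_angle_def algebra_simps)
  also have "cis (2 * pi * real i - pi) = -1"
    using cis_multiple_2pi[of "real i"] by (simp flip: minus_cis')
  finally show ?thesis .
qed

lemma bij_betw_unit_trap_node:
  assumes "m > 0"
  shows "bij_betw (trap_node 0 1 m) {1..m} {x. x ^ m = -1}"
proof -
  have inj: "inj_on (trap_node 0 1 m) {1..m}"
    using assms by (intro trap_node_inj) auto
  have "trap_node 0 1 m ` {1..m} = {x. x ^ m = -1}"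
  proof (rule card_subset_eq)
    show "trap_node 0 1 m ` {1..m} \<subseteq> {x. x ^ m = -1}"
      using assms by (auto simp: unit_trap_node_power)
    show "card (trap_node 0 1 m ` {1..m}) = card {x :: complex. x ^ m = -1}"
      unfolding card_image[OF inj] using assms by (simp add: card_nth_roots)
  qed (use assms in auto)
  with inj show ?thesis by (simp add: bij_betw_def)
qed

lemma trap_R_summand_conv_unit:
  assumes "r \<noteq> 0"
  shows "rf_const (trap_weight r k i) / (rf_const (trap_node c r k i) - rf_Z)
    = rf_const (trap_node 0 1 k i / of_nat k) / (rf_const (trap_node 0 1 k i) - rf_scaled c r)"
proof -
  have "trap_weight r k i = of_real r * (trap_node 0 1 k i / of_nat k)"
    by (simp add: trap_weight_def trap_node_def)
  moreover have "rf_const (trap_node c r k i) - rf_Z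
      = rf_const (of_real r) * (rf_const (trap_node 0 1 k i) - rf_scaled c r)"
    using assms by (simp add: trap_node_def rf_scaled_def rf_const_add rf_const_mult field_simps)
  ultimately show ?thesis
    using assms by (simp only: rf_const_mult) simp
qed

lemma trap_R_closed_form:
  assumes "r \<noteq> 0" and "k > 0"
  shows "trap_R c r k = 1 / (1 + rf_scaled c r ^ k)"
proof -
  let ?f = "\<lambda>x. rf_const (x / of_nat k) / (rf_const x - rf_scaled c r)"
  have "trap_R c r k = (\<Sum>i = 1..k. ?f (trap_node 0 1 k i))"
    using assms by (simp add: trap_R_def trap_R_summand_conv_unit)
  also have "\<dots> = (\<Sum>x | x ^ k = -1. ?f x)"
    using assms by (intro sum.reindex_bij_betw bij_betw_unit_trap_node)
  also have "\<dots> = 1 / (1 + rf_scaled c r ^ k)"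
    using assms by (intro partial_fractions_one_plus_power one_plus_rf_scaled_power_nonzero)
  finally show ?thesis .
qed

lemma rf_comp_trap_R_0_1:
  assumes "m > 0" and "1 + g ^ m \<noteq> 0"
  shows "rf_comp (trap_R 0 1 m) g = 1 / (1 + g ^ m)"
proof -
  have "trap_R 0 1 m = 1 / to_fract (1 + [:0, 1:] ^ m)"
    using assms by (simp add: trap_R_closed_form rf_scaled_conv_to_fract to_fract_power)
  also have "\<dots> = Fract 1 (1 + [:0, 1:] ^ m)"
    by (simp add: Fract_conv_to_fract)
  finally show ?thesis
    using assms
    by (simp add: rf_comp_Fract rf_eval_poly_add rf_eval_poly_power rf_eval_poly_pCons)
qed

lemma rf_comp_rf_M:
  assumes "g \<noteq> 0"
  shows "rf_comp rf_M g = (1 - g) / g"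
proof -
  have "rf_M = Fract [:1, -1:] [:0, 1:]"
    by (simp add: rf_M_def rf_Z_def Fract_conv_to_fract one_pCons
             flip: to_fract_1 to_fract_diff)
  then show ?thesis
    using assms rf_comp_Fract[of "[:0, 1:]" g "[:1, -1:]"]
    by (simp add: rf_eval_poly_pCons rf_const_minus)
qed

lemma rf_comp_rf_M_trap_R:
  assumes "r \<noteq> 0" and "k > 0"
  shows "rf_comp rf_M (trap_R c r k) = rf_scaled c r ^ k"
  using assms one_plus_rf_scaled_power_nonzero[of c r k]
  by (simp add: trap_R_closed_form rf_comp_rf_M field_simps)

lemma trap_R_mult_conv_rf_comp:
  assumes "r \<noteq> 0" and "k1 > 0" and "k2 > 0"
  shows "trap_R c r (k1 * k2) = rf_comp (trap_R 0 1 k2) (rf_comp rf_M (trap_R c r k1))"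
  using assms one_plus_rf_scaled_power_nonzero[of c r "k1 * k2"]
  by (simp add: rf_comp_rf_M_trap_R rf_comp_trap_R_0_1 power_mult)
     (simp add: trap_R_closed_form power_mult)

lemma trap_R_mult_conv_pole_terms:
  assumes "r \<noteq> 0" and "k1 > 0" and "k2 > 0"
  shows "trap_R c r (k1 * k2) = (\<Sum>x\<in>{x. x ^ k2 = -1} - {-1}. pole_term k2 x (trap_R c r k1))
    + (if odd k2 then rf_const (1 / of_nat k2) * trap_R c r k1 else 0)"
  using assms one_plus_rf_scaled_power_nonzero[of c r k1]
    one_plus_rf_scaled_power_nonzero[of c r "k1 * k2"]
    inverse_one_plus_power_conv_pole_terms[of k2 "rf_scaled c r ^ k1"]
  by (simp add: trap_R_closed_form power_mult)

theorem theorem5p1: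
  fixes c :: complex and r :: real and k k1 k2 :: nat
  assumes "r > 0" and "k1 > 0" and "k2 > 0" and "k = k1 * k2"
  shows "trap_R c r k = rf_comp (trap_R 0 1 k2) (rf_comp rf_M (trap_R c r k1)) \<and>
    (\<forall>\<sigma> :: nat \<Rightarrow> complex. bij_betw \<sigma> {1..k2} {x. x ^ k2 = -1} \<longrightarrow>
      (even k2 \<longrightarrow>
        trap_R c r k =
          (\<Sum>i = 1..k2. rf_const (coef_c k2 (\<sigma> i)) *
             inverse (rf_const (shift_s (\<sigma> i)) - trap_R c r k1) * trap_R c r k1)) \<and>
      (odd k2 \<and> \<sigma> k2 = -1 \<longrightarrow>
        trap_R c r k =
          (\<Sum>i = 1..k2 - 1. rf_const (coef_c k2 (\<sigma> i)) *
             inverse (rf_const (shift_s (\<sigma> i)) - trap_R c r k1) * trap_R c r k1)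
          + rf_const (1 / of_nat k2) * trap_R c r k1))"
proof (fold pole_term_def, intro conjI allI impI)
  let ?R = "trap_R c r k1" and ?S = "{x :: complex. x ^ k2 = -1}"
  show "trap_R c r k = rf_comp (trap_R 0 1 k2) (rf_comp rf_M ?R)"
    using assms by (simp add: trap_R_mult_conv_rf_comp)
  fix \<sigma> :: "nat \<Rightarrow> complex"
  assume \<sigma>: "bij_betw \<sigma> {1..k2} ?S"
  have reindex: "(\<Sum>x\<in>?S - {-1}. pole_term k2 x ?R) = (\<Sum>i\<in>I. pole_term k2 (\<sigma> i) ?R)"
    if "bij_betw \<sigma> I (?S - {-1})" for I
    by (rule sum.reindex_bij_betw[OF that, symmetric])
  show "trap_R c r k = (\<Sum>i = 1..k2. pole_term k2 (\<sigma> i) ?R)" if "even k2"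
  proof -
    have "?S - {-1} = ?S" using that by auto
    with \<sigma> have "bij_betw \<sigma> {1..k2} (?S - {-1})" by (simp only:)
    from reindex[OF this] show ?thesis
      using that assms by (simp add: trap_R_mult_conv_pole_terms)
  qed
  show "trap_R c r k = (\<Sum>i = 1..k2 - 1. pole_term k2 (\<sigma> i) ?R) + rf_const (1 / of_nat k2) * ?R"
    if "odd k2 \<and> \<sigma> k2 = -1"
    using that assms reindex bij_betw_atLeastAtMost_remove_last[OF \<sigma>]
    by (simp add: trap_R_mult_conv_pole_terms)
qed

end
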